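(* If $G$ is a graph with $\chi(G) = \chi_{\rho}(G)\ge 3$, then $\omega(G) = \chi(G)$.
   Context: All graphs are finite and simple. $\omega(G)$ is the clique number and $\chi(G)$ the chromatic number of $G$. For a positive integer $i$, an $i$-packing in $G$ is a set $W\subseteq V(G)$ such that any two distinct vertices of $W$ are at distance greater than $i$ in $G$. The packing chromatic number $\chi_{\rho}(G)$ is the smallest integer $k$ such that $V(G)$ can be partitioned into sets $V_1,\dots,V_k$ with $V_i$ an $i$-packing for each $i\in\{1,\dots,k\}$. *)

theory Defs
  imports "Graph_Theory.Graph_Theory" "HOL-Library.Disjoint_Sets"
begin

text \<open>
  A finite simple graph is an instance of the locale \<open>graph\<close>: a finite symmetric digraph
  without loops and without parallel arcs, each edge being a pair of opposite arcs.
\<close>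

text \<open>
  The distance is the infimum of the lengths of the walks between two vertices; it is
  \<open>\<infinity>\<close> if they lie in different components.
\<close>

definition graph_dist :: "('a, 'b) pre_digraph \<Rightarrow> 'a \<Rightarrow> 'a \<Rightarrow> ereal" where
  "graph_dist G u v = wf_digraph.\<mu> G (\<lambda>_. 1) u v"

definition clique :: "('a, 'b) pre_digraph \<Rightarrow> 'a set \<Rightarrow> bool" where
  "clique G C \<longleftrightarrow> C \<subseteq> verts G \<and> (\<forall>u\<in>C. \<forall>v\<in>C. u \<noteq> v \<longrightarrow> u \<rightarrow>\<^bsub>G\<^esub> v)"

definition clique_number :: "('a, 'b) pre_digraph \<Rightarrow> nat" where
  "clique_number G = Max {card C | C. clique G C}"

definition proper_coloring :: "('a, 'b) pre_digraph \<Rightarrow> nat \<Rightarrow> ('a \<Rightarrow> nat) \<Rightarrow> bool" where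
  "proper_coloring G k c \<longleftrightarrow>
     (\<forall>v\<in>verts G. c v \<in> {1..k}) \<and>
     (\<forall>u\<in>verts G. \<forall>v\<in>verts G. u \<rightarrow>\<^bsub>G\<^esub> v \<longrightarrow> c u \<noteq> c v)"

definition chromatic_number :: "('a, 'b) pre_digraph \<Rightarrow> nat" where
  "chromatic_number G = (LEAST k. \<exists>c. proper_coloring G k c)"

definition packing :: "('a, 'b) pre_digraph \<Rightarrow> nat \<Rightarrow> 'a set \<Rightarrow> bool" where
  "packing G i W \<longleftrightarrow>
     W \<subseteq> verts G \<and> (\<forall>u\<in>W. \<forall>v\<in>W. u \<noteq> v \<longrightarrow> ereal (real i) < graph_dist G u v)"

text \<open>
  Classes may be empty. This does not affect the minimal \<open>k\<close>: an empty class \<open>V i\<close> with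
  \<open>i < k\<close> can be replaced by \<open>V k\<close>, which is also an \<open>i\<close>-packing.
\<close>

definition packing_partition :: "('a, 'b) pre_digraph \<Rightarrow> nat \<Rightarrow> (nat \<Rightarrow> 'a set) \<Rightarrow> bool" where
  "packing_partition G k V \<longleftrightarrow>
     (\<Union>i\<in>{1..k}. V i) = verts G \<and> disjoint_family_on V {1..k} \<and>
     (\<forall>i\<in>{1..k}. packing G i (V i))"

definition packing_chromatic_number :: "('a, 'b) pre_digraph \<Rightarrow> nat" where
  "packing_chromatic_number G = (LEAST k. \<exists>V. packing_partition G k V)"

end

theory Submission
  imports Defs
begin

text \<open>
  Let \<open>V\<^sub>1, \<dots>, V\<^sub>k\<close> be a packing partition with \<open>k = \<chi>(G)\<close>, and suppose that there is no \<open>k\<close>-clique.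
  Every \<open>v \<in> V\<^sub>k\<close> can then be given a smaller colour by recolouring a few vertices around it.
  This is immediate if \<open>v\<close> misses a colour. Otherwise, for \<open>2 \<le> i < k\<close>, it has a unique neighbour
  \<open>x\<^sub>i\<close> in \<open>V\<^sub>i\<close>. If \<open>x\<^sub>i\<close> and \<open>x\<^sub>j\<close> are not adjacent, where \<open>i < j\<close>, then \<open>x\<^sub>i\<close> has no neighbour of colour \<open>j\<close>,
  because \<open>V\<^sub>j\<close> is a 3-packing; so \<open>x\<^sub>i\<close> gets colour \<open>j\<close> and \<open>v\<close> gets colour \<open>i\<close>. If the \<open>x\<^sub>i\<close> form a
  clique, the neighbours of \<open>v\<close> in \<open>V\<^sub>1\<close> that are not adjacent to some \<open>x\<^sub>j\<close> with \<open>j \<ge> 3\<close> get colour \<open>j\<close>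
  in the same way; the remaining ones are not adjacent to \<open>x\<^sub>2\<close>. Since \<open>V\<^sub>2\<close> is a 2-packing, the
  vertices of colours 1 and 2 connected to \<open>x\<^sub>2\<close> form a star, whose colours can be
  exchanged, and colour 2 becomes free for \<open>v\<close>. The vertices of \<open>V\<^sub>k\<close> are so far apart that these
  recolourings do not interfere, and together they give a proper colouring with \<open>k - 1\<close> colours.
\<close>

section \<open>Recolouring around one vertex of the top colour\<close>

locale packing_coloring =
  fixes E :: "'v \<Rightarrow> 'v \<Rightarrow> bool" and c :: "'v \<Rightarrow> nat" and k :: nat
  assumes sym: "E u w \<Longrightarrow> E w u"
    and k3: "3 \<le> k"
    and range: "c u \<in> {1..k}"
    and proper: "E u w \<Longrightarrow> c u \<noteq> c w"
    and packing2: "\<lbrakk>E u a; E a w; c u = c w; 2 \<le> c u\<rbrakk> \<Longrightarrow> u = w"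
    and packing3: "\<lbrakk>E u a; E a b; E b w; c u = c w; 3 \<le> c u\<rbrakk> \<Longrightarrow> u = w"
    and packing4: "\<lbrakk>E u a; E a b; E b d; E d w; c u = c w; 4 \<le> c u\<rbrakk> \<Longrightarrow> u = w"
begin

text \<open>All vertices that the recolouring around \<open>v\<close> may change; the last set holds
  the leaves of the star in colours 1 and 2 centred at a neighbour of \<open>v\<close>.\<close>

definition region :: "'v \<Rightarrow> 'v set" where
  "region v = {v} \<union> {u. E v u} \<union> {w. c w = 1 \<and> (\<exists>x. E v x \<and> c x = 2 \<and> E x w)}"

text \<open>Colour \<open>k\<close> has to disappear only from the region, while \<open>f\<close>
  stays proper on all edges; this allows gluing.\<close>

definition local_recoloring :: "'v \<Rightarrow> ('v \<Rightarrow> nat) \<Rightarrow> bool" where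
  "local_recoloring v f \<longleftrightarrow>
     (\<forall>u. u \<notin> region v \<longrightarrow> f u = c u) \<and>
     (\<forall>u\<in>region v. f u \<in> {1..k-1}) \<and>
     (\<forall>u w. E u w \<longrightarrow> f u \<noteq> f w)"

lemma color_less_top:
  assumes "c v = k" "u \<in> region v" "u \<noteq> v"
  shows "c u \<in> {1..k-1}"
proof -
  have "c u \<noteq> k" using assms proper[of v u] k3 by (auto simp: region_def)
  then show ?thesis using range[of u] by auto
qed

text \<open>Edges between unchanged vertices inherit properness from \<open>c\<close>, and unchanged
  vertices of the region other than \<open>v\<close> already have colours below
  \<open>k\<close>.\<close>

lemma local_recoloringI:
  assumes v: "c v = k"
    and outside: "\<And>u. u \<notin> region v \<Longrightarrow> f u = c u"
    and changed: "\<And>u. f u \<noteq> c u \<or> u = v \<Longrightarrow> f u \<in> {1..k-1}"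
    and valid: "\<And>u w. \<lbrakk>E u w; f u \<noteq> c u\<rbrakk> \<Longrightarrow> f u \<noteq> f w"
  shows "local_recoloring v f"
  unfolding local_recoloring_def
proof (intro conjI allI ballI impI)
  fix u assume "u \<in> region v"
  then show "f u \<in> {1..k-1}" using changed[of u] color_less_top[OF v, of u] by metis
next
  fix u w assume "E u w"
  then show "f u \<noteq> f w" using valid[of u w] valid[of w u] sym[of u w] proper[of u w] by metis
qed (use outside in auto)

lemma local_recoloring_exists:
  assumes v: "c v = k"
    and no_clique: "\<nexists>x. \<forall>i\<in>{1..k}. \<forall>j\<in>{1..k}. i \<noteq> j \<longrightarrow> E (x i) (x j)"
  shows "\<exists>f. local_recoloring v f"
proof (cases "\<forall>i\<in>{1..k-1}. \<exists>u. E v u \<and> c u = i")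
  case False
  then obtain i where i: "i \<in> {1..k-1}" and no: "\<And>u. E v u \<Longrightarrow> c u \<noteq> i" by blast
  have "local_recoloring v (c(v := i))"
  proof (rule local_recoloringI[OF v])
    fix u w assume "E u w" "(c(v := i)) u \<noteq> c u"
    then show "(c(v := i)) u \<noteq> (c(v := i)) w"
      using no proper by (auto split: if_splits)
  next
    fix u assume "u \<notin> region v"
    then show "(c(v := i)) u = c u" by (simp add: region_def)
  next
    fix u assume "(c(v := i)) u \<noteq> c u \<or> u = v"
    then show "(c(v := i)) u \<in> {1..k-1}" using i by (metis fun_upd_apply)
  qed
  then show ?thesis by blast
next
  case True
  then obtain x where x: "\<And>i. i \<in> {1..k-1} \<Longrightarrow> E v (x i) \<and> c (x i) = i" by metis
  \<comment> \<open>Colour 1 is excluded: \<open>v\<close> may have several neighbours of that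
    colour.\<close>
  have uniq: "u = x i" if "E v u" "c u = i" "i \<in> {2..k-1}" for u i
    using packing2[of u v "x i"] x[of i] sym[of v u] that by auto
  \<comment> \<open>The walk \<open>u\<close>, \<open>y\<close>, \<open>v\<close>,
    \<open>x j\<close> has length 3, so this needs a colour \<open>j\<close> \<ge> 3.\<close>
  have far: "u = x j" if "E u y" "E v y" "c u = j" "j \<in> {3..k-1}" for u y j
    using packing3[of u y v "x j"] x[of j] sym[of v y] that by auto
  show ?thesis
  proof (cases "\<exists>i j. 2 \<le> i \<and> i < j \<and> j \<le> k-1 \<and> \<not> E (x i) (x j)")
    case True
    then obtain i j where ij: "2 \<le> i" "i < j" "j \<le> k-1" and nonadj: "\<not> E (x i) (x j)"
      by blast
    have xi: "E v (x i)" "c (x i) = i" using x[of i] ij by auto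
    have ne: "x i \<noteq> v" using xi v ij by auto
    let ?f = "c(v := i, x i := j)"
    have "local_recoloring v ?f"
    proof (rule local_recoloringI[OF v])
      fix u w assume E: "E u w" and "?f u \<noteq> c u"
      then consider "u = v" | "u = x i" by (auto split: if_splits)
      then show "?f u \<noteq> ?f w"
      proof cases
        case 1
        then have "c w \<noteq> i \<or> w = x i" using uniq[of w i] E ij by auto
        then show ?thesis using 1 ne ij proper E by auto
      next
        case 2
        then have "c w \<noteq> j"
          using far[of w "x i" j] sym[OF E] xi ij nonadj E by auto
        then show ?thesis using 2 ne ij proper[OF E] by auto
      qed
    next
      fix u assume "u \<notin> region v"
      then show "?f u = c u" using xi by (auto simp: region_def)
    next
      fix u assume "?f u \<noteq> c u \<or> u = v"
      then show "?f u \<in> {1..k-1}" using ij by (cases "u = x i"; cases "u = v") auto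
    qed
    then show ?thesis by blast
  next
    case False
    then have adj: "E (x i) (x j)" if "i \<in> {2..k-1}" "j \<in> {2..k-1}" "i \<noteq> j" for i j
      using that sym by (metis atLeastAtMost_iff linorder_neqE_nat)
    \<comment> \<open>\<open>R\<close> consists of the neighbours of \<open>v\<close> that can
      escape to a colour \<ge> 3; \<open>W\<close> consists of the remaining leaves around
      \<open>x 2\<close>, which take colour 2 in the exchange.\<close>
    define R where "R = {a. E v a \<and> c a = 1 \<and> (\<exists>j\<in>{3..k-1}. \<not> E a (x j))}"
    define W where "W = {w. c w = 1 \<and> E (x 2) w} - R"
    have "\<forall>a\<in>R. \<exists>j. j \<in> {3..k-1} \<and> \<not> E a (x j)" by (auto simp: R_def)
    then obtain h where h: "\<And>a. a \<in> R \<Longrightarrow> h a \<in> {3..k-1} \<and> \<not> E a (x (h a))" by metis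
    have x2: "E v (x 2)" "c (x 2) = 2" using x[of 2] k3 by auto
    have ne: "x 2 \<noteq> v" using x2 v k3 by auto
    have vR: "v \<notin> R" "v \<notin> W" "x 2 \<notin> R" "x 2 \<notin> W" using v k3 x2 by (auto simp: R_def W_def)
    have WR: "R \<inter> W = {}" by (auto simp: W_def)
    have c1: "c a = 1" if "a \<in> R \<union> W" for a using that by (auto simp: R_def W_def)
    have nonadj: "\<not> E v w" if "w \<in> W" for w
    proof
      assume vw: "E v w"
      \<comment> \<open>Since \<open>w\<close> is not in \<open>R\<close>, it is adjacent to every
        \<open>x j\<close>, and together with \<open>v\<close> these form a \<open>k\<close>-clique,
        listed by colour in \<open>?y\<close>.\<close>
      have w: "E w (x j)" if "j \<in> {2..k-1}" for j
        using that \<open>w \<in> W\<close> vw sym[of "x 2" w] by (cases "j = 2") (auto simp: W_def R_def)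
      let ?y = "x(1 := w, k := v)"
      have "E (?y i) (?y j)" if "i \<in> {1..k}" "j \<in> {1..k}" "i \<noteq> j" for i j
      proof -
        have m: "l = 1 \<or> l = k \<or> l \<in> {2..k-1}" if "l \<in> {1..k}" for l :: nat
          using that by auto
        show ?thesis
          using m[OF that(1)] m[OF that(2)] that(3) k3 vw sym[OF vw] w[of i] w[of j]
            sym[of w "x i"] sym[of w "x j"] adj[of i j] x[of i] x[of j] sym[of v "x i"] sym[of v "x j"]
          by auto
      qed
      then show False using no_clique by blast
    qed
    let ?f = "\<lambda>u. if u = v then 2 else if u = x 2 then 1 else if u \<in> R then h u
      else if u \<in> W then 2 else c u"
    have "local_recoloring v ?f"
    proof (rule local_recoloringI[OF v])
      fix u assume "u \<notin> region v"
      then show "?f u = c u" using x2 by (auto simp: region_def R_def W_def)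
    next
      fix u assume "?f u \<noteq> c u \<or> u = v"
      moreover have "1 \<in> {1..k-1}" "2 \<in> {1..k-1}" using k3 by auto
      moreover have "h u \<in> {1..k-1}" if "u \<in> R" using h[OF that] by auto
      ultimately show "?f u \<in> {1..k-1}"
        by metis
    next
      fix u w assume E: "E u w" and "?f u \<noteq> c u"
      then consider "u = v" | "u = x 2" | "u \<in> R" | "u \<in> W" by (auto split: if_splits)
      then show "?f u \<noteq> ?f w"
      proof cases
        case 1
        have "w \<noteq> v" using E proper 1 by auto
        moreover have "w \<notin> W" using nonadj E 1 by auto
        moreover have "c w \<noteq> 2 \<or> w = x 2" using uniq[of w 2] E 1 k3 by auto
        moreover have "w \<in> R \<Longrightarrow> h w \<noteq> 2" using h[of w] by auto
        ultimately show ?thesis using 1 by auto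
      next
        case 2
        have "w \<noteq> x 2" using E proper 2 by auto
        moreover have "c w = 1 \<Longrightarrow> w \<in> R \<union> W" using E 2 by (auto simp: W_def)
        moreover have "w \<in> R \<Longrightarrow> h w \<noteq> 1" using h[of w] by auto
        ultimately show ?thesis using 2 ne by auto
      next
        case 3
        have "w \<notin> R \<union> W" using proper[OF E] c1[of u] c1[of w] 3 by auto
        \<comment> \<open>A neighbour of \<open>u\<close> with colour \<open>h u\<close> could only
          be \<open>x (h u)\<close>, which \<open>h\<close> was chosen to avoid.\<close>
        moreover have "h u \<noteq> c w"
          using far[of w u "h u"] sym[OF E] h[OF 3] 3 E by (auto simp: R_def)
        moreover have "h u \<ge> 3" using h[OF 3] by auto
        moreover have "u \<noteq> v" "u \<noteq> x 2" using 3 vR by auto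
        ultimately show ?thesis using 3 by auto
      next
        case 4
        have "w \<notin> R \<union> W" using proper[OF E] c1[of u] c1[of w] 4 by auto
        moreover have "w \<noteq> v" using nonadj[OF 4] E sym by auto
        \<comment> \<open>The only colour-2 neighbour of a leaf is the centre \<open>x 2\<close>,
          which has moved to colour 1.\<close>
        moreover have "c w = 2 \<Longrightarrow> w = x 2"
          using packing2[of w u "x 2"] sym[OF E] sym[of "x 2" u] 4 x2 by (auto simp: W_def)
        moreover have "u \<noteq> v" "u \<noteq> x 2" "u \<notin> R" using 4 vR WR by auto
        ultimately show ?thesis using 4 by auto
      qed
    qed
    then show ?thesis by blast
  qed
qed


section \<open>Separation of regions and gluing of the recolourings\<close>

lemma no_edge_between_regions:
  assumes "c v = k" "c v' = k" "v \<noteq> v'" "u \<in> region v" "u' \<in> region v'"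
  shows "\<not> E u u'"
proof
  assume E: "E u u'"
  \<comment> \<open>Here \<open>w\<close> is a leaf of a star. The walk \<open>v\<close>,
    \<open>u\<close>, \<open>w\<close>, \<open>x\<close>, \<open>v'\<close> of length 4 is excluded
    only by colours \<ge> 4, but \<open>u\<close> has a colour other than 1, 2 and \<open>k\<close>,
    which forces \<open>k\<close> \<ge> 4.\<close>
  have mixed: False
    if *: "c v = k" "c v' = k" "v \<noteq> v'" "E v u \<or> u = v" "E v' x" "c x = 2" "E x w" "c w = 1" "E u w"
    for v v' u x w
  proof -
    note [dest] = sym
    have "u \<noteq> v"
      using packing3[of v w x v'] * k3 by auto
    then have vu: "E v u" using * by auto
    have "c u \<noteq> 1" using proper * by metis
    moreover have "c u \<noteq> 2"
      using packing2[of u w x] packing2[of v x v'] * vu k3 by auto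
    moreover have "c u \<noteq> k" using proper[OF vu] * by auto
    ultimately have "4 \<le> k" using range[of u] by auto
    then show False using packing4[of v u w x v'] * vu by auto
  qed
  have near: False if "E v u \<or> u = v" "E v' u' \<or> u' = v'"
    using that E assms k3 proper[of v v'] packing2[of v u v'] packing2[of v u' v']
      packing3[of v u u' v'] sym[of v' u'] by auto
  \<comment> \<open>This settles the case of two leaves, where walks between \<open>v\<close> and
    \<open>v'\<close> would be too long.\<close>
  have one: "\<not> (c u = 1 \<and> c u' = 1)" using proper[OF E] by auto
  show False
    using assms(4,5) near one mixed[of v v' u _ u'] mixed[of v' v u' _ u] assms(1-3) E sym[OF E]
    unfolding region_def by blast
qed

text \<open>A common vertex gives a walk of length at most 3 between \<open>v\<close> and
  \<open>v'\<close>, unless it is a leaf for both. Then the two centres coincide because colour 2 is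
  a 2-packing, and a walk of length 2 results.\<close>

lemma regions_disjoint:
  assumes "c v = k" "c v' = k" "u \<in> region v" "u \<in> region v'"
  shows "v = v'"
proof (rule ccontr)
  assume ne: "v \<noteq> v'"
  have near: False if "E v u \<or> u = v" "E v' u \<or> u = v'"
    using that ne assms(1,2) k3 proper[of v v'] packing2[of v u v'] sym[of v' u] proper[of v' v] by auto
  have mixed: False
    if "c v = k" "c v' = k" "v \<noteq> v'" "E v u \<or> u = v" "E v' x" "c x = 2" "E x u" for v v' u x
    using that k3 packing2[of v x v'] packing3[of v u x v'] sym[of v' x] sym[of x u] by auto
  have far: False if "E v x" "c x = 2" "E x u" "E v' x'" "c x' = 2" "E x' u" for x x'
    using that ne assms(1,2) k3 packing2[of x u x'] packing2[of v x v'] sym[of v' x'] sym[of x' u]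
    by auto
  show False
    using assms ne near far mixed[of v v' u] mixed[of v' v u] unfolding region_def by blast
qed

text \<open>If an edge meets the region of \<open>v\<close>, its other end lies in the same region
  or in none, where \<open>f v\<close> agrees with \<open>c\<close>; so both ends are coloured by
  \<open>f v\<close>.\<close>

theorem fewer_colors:
  assumes no_clique: "\<nexists>x. \<forall>i\<in>{1..k}. \<forall>j\<in>{1..k}. i \<noteq> j \<longrightarrow> E (x i) (x j)"
  shows "\<exists>g. (\<forall>u. g u \<in> {1..k-1}) \<and> (\<forall>u w. E u w \<longrightarrow> g u \<noteq> g w)"
proof -
  obtain f where f: "\<And>v. c v = k \<Longrightarrow> local_recoloring v (f v)"
    using local_recoloring_exists[OF _ no_clique] by metis
  define g where
    "g u = (if \<exists>v. c v = k \<and> u \<in> region v then f (THE v. c v = k \<and> u \<in> region v) u else c u)" for u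
  have g: "g u = f v u" if "c v = k" "u \<in> region v" for u v
  proof -
    have "(THE v. c v = k \<and> u \<in> region v) = v"
      using that regions_disjoint by (intro the_equality) auto
    then show ?thesis using that by (auto simp: g_def)
  qed
  have g': "g u = c u" if "\<nexists>v. c v = k \<and> u \<in> region v" for u
    using that by (auto simp: g_def)
  have self: "v \<in> region v" for v by (simp add: region_def)
  have "g u \<in> {1..k-1}" for u
  proof (cases "\<exists>v. c v = k \<and> u \<in> region v")
    case True
    then obtain v where v: "c v = k" "u \<in> region v" by blast
    then show ?thesis using f[OF v(1)] g[OF v] by (auto simp: local_recoloring_def)
  next
    case False
    then have "c u \<noteq> k" using self by blast
    then show ?thesis using range[of u] g'[OF False] by auto
  qed
  moreover have inside: "g u \<noteq> g w" if E: "E u w" and v: "c v = k" "u \<in> region v" for u w v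
  proof -
    have "g w = f v w"
    proof (cases "\<exists>v'. c v' = k \<and> w \<in> region v'")
      case True
      then show ?thesis using no_edge_between_regions[of v _ u w] E v g by metis
    next
      case False
      then show ?thesis using f[OF v(1)] g'[OF False] v by (auto simp: local_recoloring_def)
    qed
    then show ?thesis using f[OF v(1)] E g[OF v] by (auto simp: local_recoloring_def)
  qed
  moreover have "g u \<noteq> g w" if "E u w" for u w
    using inside[OF that] inside[OF sym[OF that]] g'[of u] g'[of w] proper[OF that] by metis
  ultimately show ?thesis by blast
qed

end

section \<open>From packing partitions to conditions on walks\<close>

context graph
begin

lemma graph_dist_le_walk_length: "awalk u p v \<Longrightarrow> graph_dist G u v \<le> ereal (real (length p))"
  using min_cost_le_walk_cost[of u p v "\<lambda>_. 1"]
  by (simp add: graph_dist_def awalk_cost_def sum_list_triv)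

lemma adj_sym: "u \<rightarrow>\<^bsub>G\<^esub> v \<Longrightarrow> v \<rightarrow>\<^bsub>G\<^esub> u"
  by (rule arcs_ends_symmetric[OF sym_arcs])

lemma adj_arc: "u \<rightarrow>\<^bsub>G\<^esub> v \<Longrightarrow> \<exists>e\<in>arcs G. u = tail G e \<and> v = head G e"
  by (auto simp: arcs_ends_conv)

lemma relpow_adj_awalk:
  assumes "u \<in> verts G" "(u, v) \<in> arcs_ends G ^^ n"
  shows "\<exists>p. awalk u p v \<and> length p = n"
  using assms
proof (induction n arbitrary: u)
  case 0
  then show ?case by (auto simp: awalk_Nil_iff)
next
  case (Suc n)
  then obtain w where w: "u \<rightarrow>\<^bsub>G\<^esub> w" "(w, v) \<in> arcs_ends G ^^ n" by (meson relpow_Suc_D2)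
  obtain p where p: "awalk w p v" "length p = n"
    using Suc.IH[OF adj_in_verts(2)[OF w(1)] w(2)] by blast
  obtain e where "e \<in> arcs G" "u = tail G e" "w = head G e"
    using adj_arc[OF w(1)] by blast
  then have "awalk u (e # p) v \<and> length (e # p) = Suc n"
    using p by (simp add: awalk_Cons_iff)
  then show ?case by blast
qed

lemma packing_relpow:
  assumes W: "packing G i W" and uv: "u \<in> W" "v \<in> W" "(u, v) \<in> arcs_ends G ^^ n" "n \<le> i"
  shows "u = v"
proof (rule ccontr)
  assume "u \<noteq> v"
  then have far: "ereal (real i) < graph_dist G u v" using W uv by (auto simp: packing_def)
  have "u \<in> verts G" using W uv by (auto simp: packing_def)
  then obtain p where p: "awalk u p v" "length p = n" using relpow_adj_awalk uv by blast
  then have "graph_dist G u v \<le> ereal (real n)" using graph_dist_le_walk_length by metis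
  also have "\<dots> \<le> ereal (real i)" using uv by simp
  finally show False using far by simp
qed

text \<open>Singletons are packings for every \<open>i\<close>; hence the \<open>LEAST\<close> in
  the packing chromatic number is attained.\<close>

lemma ex_packing_partition: "\<exists>k V. packing_partition G k V"
proof -
  obtain f where f: "bij_betw f {1..card (verts G)} (verts G)"
    using ex_bij_betw_nat_finite_1[OF finite_verts] by blast
  have "packing_partition G (card (verts G)) (\<lambda>i. {f i})"
    using f unfolding packing_partition_def disjoint_family_on_def packing_def bij_betw_def
    by (auto dest: inj_onD)
  then show ?thesis by blast
qed

lemma packing_partition_coloring:
  assumes part: "packing_partition G k V" and k3: "3 \<le> k"
  obtains c where "packing_coloring (\<lambda>u v. u \<rightarrow>\<^bsub>G\<^esub> v) c k"
proof -
  have ex: "\<exists>i. i \<in> {1..k} \<and> u \<in> V i" if "u \<in> verts G" for u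
    using part that unfolding packing_partition_def by blast
  \<comment> \<open>The default 1 serves elements outside the graph, since the locale bounds
    \<open>c\<close> on the whole type.\<close>
  define c where "c u = (if u \<in> verts G then SOME i. i \<in> {1..k} \<and> u \<in> V i else 1)" for u
  have c: "c u \<in> {1..k} \<and> u \<in> V (c u)" if "u \<in> verts G" for u
    using someI_ex[OF ex[OF that]] that by (simp add: c_def)
  have far: "u = w"
    if "(u, w) \<in> arcs_ends G ^^ n" "c u = c w" "n \<le> c u" "u \<in> verts G" "w \<in> verts G" for u w n
    using packing_relpow[of "c u" "V (c u)" u w n] that c[of u] c[of w] part
    unfolding packing_partition_def by auto
  have path2: "(u, w) \<in> arcs_ends G ^^ 2" if "u \<rightarrow>\<^bsub>G\<^esub> a" "a \<rightarrow>\<^bsub>G\<^esub> w" for u a w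
    using that by (auto simp: numeral_eq_Suc)
  have path3: "(u, w) \<in> arcs_ends G ^^ 3" if "u \<rightarrow>\<^bsub>G\<^esub> a" "a \<rightarrow>\<^bsub>G\<^esub> b" "b \<rightarrow>\<^bsub>G\<^esub> w" for u a b w
    using that by (auto simp: numeral_eq_Suc)
  have path4: "(u, w) \<in> arcs_ends G ^^ 4" if "u \<rightarrow>\<^bsub>G\<^esub> a" "a \<rightarrow>\<^bsub>G\<^esub> b" "b \<rightarrow>\<^bsub>G\<^esub> d" "d \<rightarrow>\<^bsub>G\<^esub> w" for u a b d w
    using that by (auto simp: numeral_eq_Suc)
  have "packing_coloring (\<lambda>u v. u \<rightarrow>\<^bsub>G\<^esub> v) c k"
  proof
    show "c u \<in> {1..k}" for u using c[of u] k3 by (auto simp: c_def)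
    \<comment> \<open>Indices start at 1, so every class is at least a 1-packing, that is,
      independent.\<close>
    show "c u \<noteq> c w" if "u \<rightarrow>\<^bsub>G\<^esub> w" for u w
      using far[of u w 1] that adj_not_same[of u] c[of u] adj_in_verts[OF that] by auto
    show "u = w" if "u \<rightarrow>\<^bsub>G\<^esub> a" "a \<rightarrow>\<^bsub>G\<^esub> w" "c u = c w" "2 \<le> c u" for u a w
      using far[OF path2] that by (meson adj_in_verts)
    show "u = w" if "u \<rightarrow>\<^bsub>G\<^esub> a" "a \<rightarrow>\<^bsub>G\<^esub> b" "b \<rightarrow>\<^bsub>G\<^esub> w" "c u = c w" "3 \<le> c u" for u a b w
      using far[OF path3] that by (meson adj_in_verts)
    show "u = w" if "u \<rightarrow>\<^bsub>G\<^esub> a" "a \<rightarrow>\<^bsub>G\<^esub> b" "b \<rightarrow>\<^bsub>G\<^esub> d" "d \<rightarrow>\<^bsub>G\<^esub> w" "c u = c w" "4 \<le> c u" for u a b d w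
      using far[OF path4] that by (meson adj_in_verts)
  qed (use k3 adj_sym in auto)
  then show ?thesis by (rule that)
qed

lemma clique_card_le:
  assumes "proper_coloring G k c" "clique G C"
  shows "card C \<le> k"
proof -
  have "inj_on c C" "c ` C \<subseteq> {1..k}"
    using assms unfolding proper_coloring_def clique_def inj_on_def by blast+
  then show ?thesis using card_inj_on_le[of c C "{1..k}"] by simp
qed

end

theorem theorem3p3:
  fixes G :: "('a, 'b) pre_digraph"
  assumes "graph G"
    and "chromatic_number G = packing_chromatic_number G"
    and "packing_chromatic_number G \<ge> 3"
  shows "clique_number G = chromatic_number G"
proof -
  interpret graph G by fact
  let ?k = "chromatic_number G"
  have "\<exists>V. packing_partition G ?k V"
    unfolding assms(2) packing_chromatic_number_def by (rule LeastI_ex) (rule ex_packing_partition)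
  then obtain V where V: "packing_partition G ?k V" by blast
  have k3: "3 \<le> ?k" using assms by simp
  obtain c where "packing_coloring (\<lambda>u v. u \<rightarrow>\<^bsub>G\<^esub> v) c ?k"
    using packing_partition_coloring[OF V k3] .
  then interpret packing_coloring "\<lambda>u v. u \<rightarrow>\<^bsub>G\<^esub> v" c ?k .
  have c: "proper_coloring G ?k c" using range proper by (auto simp: proper_coloring_def)
  have "\<exists>x. \<forall>i\<in>{1..?k}. \<forall>j\<in>{1..?k}. i \<noteq> j \<longrightarrow> x i \<rightarrow>\<^bsub>G\<^esub> x j"
  proof (rule ccontr)
    assume "\<not> ?thesis"
    then obtain g where "\<forall>u. g u \<in> {1..?k-1}" "\<forall>u w. u \<rightarrow>\<^bsub>G\<^esub> w \<longrightarrow> g u \<noteq> g w"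
      using fewer_colors by blast
    then have "proper_coloring G (?k - 1) g" by (auto simp: proper_coloring_def)
    then have "?k \<le> ?k - 1"
      unfolding chromatic_number_def[of G] by (intro Least_le) blast
    then show False using k3 by simp
  qed
  then obtain x where x: "\<And>i j. \<lbrakk>i \<in> {1..?k}; j \<in> {1..?k}; i \<noteq> j\<rbrakk> \<Longrightarrow> x i \<rightarrow>\<^bsub>G\<^esub> x j" by blast
  have "inj_on x {1..?k}" using x adj_not_same by (metis inj_onI)
  then have card: "card (x ` {1..?k}) = ?k" by (simp add: card_image)
  \<comment> \<open>An arc to any other member of the family shows that \<open>x i\<close> is a
    vertex.\<close>
  have "x i \<in> verts G" if "i \<in> {1..?k}" for i
    using adj_in_verts(1)[OF x[of i "if i = 1 then 2 else 1"]] that k3 by auto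
  then have "clique G (x ` {1..?k})" using x unfolding clique_def by blast
  then have attained: "?k \<in> {card C | C. clique G C}" using card by force
  moreover have bound: "m \<le> ?k" if "m \<in> {card C | C. clique G C}" for m
    using that clique_card_le[OF c] by blast
  moreover have "finite {card C | C. clique G C}"
    by (rule finite_subset[of _ "{..?k}"]) (use bound in auto)
  ultimately show ?thesis unfolding clique_number_def by (intro Max_eqI)
qed

end
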